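(* Let $G$ be a multiple wheel with principal path $\overrightarrow{v_kv_1v_2}$ that has an even wheel as one of its components, where $v_3,\dots,v_{k-1}$ are the remaining vertices on the outer cycle of $G$ and $u_1,\dots,u_m$ are the vertices of $G$ not on the outer cycle. Then $P(G-\overrightarrow{v_kv_1v_2})$ contains a non-vanishing monomial $\eta\, v_1^0v_2^0v_k^0\prod_{i=3}^{k-1}v_i^{\alpha_i}\prod_{j=1}^m u_j^{\beta_j}$ with $\alpha_i\le2$ and $\beta_j\le4$.
   Context: For a graph $G$, vertices are also variables and $P(G)=\prod_{uv\in E(G),\,u<v}(u-v)$ for a fixed arbitrary orientation; a monomial is non-vanishing if its coefficient is nonzero. $G-\overrightarrow{v_kv_1v_2}$ is $G$ with edges $v_kv_1,v_1v_2$ deleted (vertices kept). An ordinary wheel consists of a cycle $v_1\dots v_kv_1$ ($k\ge3$) and a vertex adjacent to all $v_i$; it is even if $k$ is even and odd if $k$ is odd. A broken wheel consists of a path $v_2\dots v_k$ ($k\ge3$) and a vertex $v_1$ adjacent to all of $v_2,\dots,v_k$. For both, $\overrightarrow{v_kv_1v_2}$ is the principal path, $v_kv_1,v_1v_2$ the principal edges, $v_1,v_2,v_k$ the principal vertices. A double wheel is obtained from two graphs, each an ordinary or broken wheel, by identifying their vertices $v_1$ and identifying a principal edge of one with a principal edge of the other (the two pieces on opposite sides of the identified edge in the plane); iterating (gluing further ordinary or broken wheels along a principal edge at $v_1$) gives multiple wheels, with at least one component an ordinary wheel. The glued ordinary/broken wheels are the components; the common vertex is $v_1$, the two never-identified principal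 vertices are $v_2,v_k$, and $\overrightarrow{v_kv_1v_2}$ is the principal path of the multiple wheel. *)

theory Defs
  imports "HOL-Library.Poly_Mapping"
begin

record 'a ugraph =
  verts :: "'a set"
  edges :: "'a set set"

definition delete_edges :: "'a ugraph \<Rightarrow> 'a set set \<Rightarrow> 'a ugraph" where
  "delete_edges G F = \<lparr>verts = verts G, edges = edges G - F\<rparr>"

definition graph_union :: "'a ugraph \<Rightarrow> 'a ugraph \<Rightarrow> 'a ugraph" where
  "graph_union G H = \<lparr>verts = verts G \<union> verts H, edges = edges G \<union> edges H\<rparr>"

definition path_edges :: "'a list \<Rightarrow> 'a set set" where
  "path_edges xs = {{xs ! i, xs ! Suc i} | i. Suc i < length xs}"

definition cycle_edges :: "'a list \<Rightarrow> 'a set set" where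
  "cycle_edges xs = insert {last xs, hd xs} (path_edges xs)"


text \<open>
  Polynomials over the integers in the variables \<open>'a\<close> are finitely supported maps from
  monomials to coefficients, a monomial being a finitely supported exponent vector;
  multiplication on \<^typ>\<open>('a \<Rightarrow>\<^sub>0 nat) \<Rightarrow>\<^sub>0 int\<close> is convolution.
\<close>

definition Var :: "'a \<Rightarrow> ('a \<Rightarrow>\<^sub>0 nat) \<Rightarrow>\<^sub>0 int" where
  "Var v = Poly_Mapping.single (Poly_Mapping.single v 1) 1"

text \<open>
  \<open>lt u v\<close> says that the edge \<open>uv\<close> is oriented so that it contributes the factor \<open>u - v\<close>.
  It need not come from a linear order.
\<close>

definition orientation :: "('a \<Rightarrow> 'a \<Rightarrow> bool) \<Rightarrow> 'a ugraph \<Rightarrow> bool" where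
  "orientation lt G \<longleftrightarrow> (\<forall>u v. {u, v} \<in> edges G \<longrightarrow> (lt u v \<longleftrightarrow> \<not> lt v u))"

definition graph_poly :: "('a \<Rightarrow> 'a \<Rightarrow> bool) \<Rightarrow> 'a ugraph \<Rightarrow> ('a \<Rightarrow>\<^sub>0 nat) \<Rightarrow>\<^sub>0 int" where
  "graph_poly lt G = (\<Prod>(u, v) \<in> {(u, v). {u, v} \<in> edges G \<and> lt u v}. Var u - Var v)"

definition nonvanishing :: "(('a \<Rightarrow>\<^sub>0 nat) \<Rightarrow>\<^sub>0 int) \<Rightarrow> ('a \<Rightarrow>\<^sub>0 nat) \<Rightarrow> bool" where
  "nonvanishing p m \<longleftrightarrow> Poly_Mapping.lookup p m \<noteq> 0"


text \<open>
  In the following, \<open>vs = [v\<^sub>1, v\<^sub>2, \<dots>, v\<^sub>k]\<close> lists the outer cycle in cyclic order, starting with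
  the common vertex \<open>v\<^sub>1\<close>; the principal vertices are its first, second and last entry.
\<close>

definition ordinary_wheel :: "'a ugraph \<Rightarrow> 'a list \<Rightarrow> 'a \<Rightarrow> bool" where
  "ordinary_wheel G vs u \<longleftrightarrow>
     length vs \<ge> 3 \<and> distinct (u # vs) \<and>
     verts G = insert u (set vs) \<and>
     edges G = cycle_edges vs \<union> {{u, v} | v. v \<in> set vs}"

definition broken_wheel :: "'a ugraph \<Rightarrow> 'a list \<Rightarrow> bool" where
  "broken_wheel G vs \<longleftrightarrow>
     length vs \<ge> 3 \<and> distinct vs \<and>
     verts G = set vs \<and>
     edges G = path_edges (tl vs) \<union> {{hd vs, v} | v. v \<in> set (tl vs)}"

definition is_ordinary_wheel :: "'a ugraph \<Rightarrow> bool" where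
  "is_ordinary_wheel G \<longleftrightarrow> (\<exists>vs u. ordinary_wheel G vs u)"

definition is_even_wheel :: "'a ugraph \<Rightarrow> bool" where
  "is_even_wheel G \<longleftrightarrow> (\<exists>vs u. ordinary_wheel G vs u \<and> even (length vs))"

definition wheel_component :: "'a ugraph \<Rightarrow> 'a list \<Rightarrow> bool" where
  "wheel_component G vs \<longleftrightarrow> (\<exists>u. ordinary_wheel G vs u) \<or> broken_wheel G vs"

text \<open>
  \<open>glued_wheels G vs Hs\<close>: \<open>G\<close> arises from the components \<open>Hs\<close> by successively identifying
  principal edges at \<open>v\<^sub>1\<close>, and \<open>vs\<close> is its outer cycle. Identification of vertices is
  expressed by taking the union of graphs that share exactly the identified edge \<open>v\<^sub>1 x\<close>.
  As \<open>H\<close> lies on the other side of that edge, the new outer cycle runs along \<open>G\<close> from \<open>v\<^sub>2\<close>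
  to \<open>x\<close> and then along \<open>H\<close>.  A component may be listed in either direction
  (\<open>v\<^sub>1 # rs\<close> or \<open>v\<^sub>1 # rev rs\<close>), so either of its principal edges can play the role of
  \<open>v\<^sub>1 x\<close>, and building up the chain of components from one end is no restriction.
\<close>

inductive glued_wheels :: "'a ugraph \<Rightarrow> 'a list \<Rightarrow> 'a ugraph list \<Rightarrow> bool" where
  single: "wheel_component G vs \<Longrightarrow> glued_wheels G vs [G]"
| glue: "\<lbrakk>glued_wheels G (v1 # ps @ [x]) Hs;
          wheel_component H (v1 # x # qs);
          verts G \<inter> verts H = {v1, x}\<rbrakk>
         \<Longrightarrow> glued_wheels (graph_union G H) (v1 # ps @ x # qs) (Hs @ [H])"

definition multiple_wheel :: "'a ugraph \<Rightarrow> 'a list \<Rightarrow> 'a ugraph list \<Rightarrow> bool" where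
  "multiple_wheel G vs Hs \<longleftrightarrow>
     glued_wheels G vs Hs \<and> length Hs \<ge> 2 \<and> (\<exists>H \<in> set Hs. is_ordinary_wheel H)"

end

theory Submission
  imports Defs
begin

text \<open>
  Delete the principal path of a component and let \<open>c, d\<close> be the exponents, at its two outer
  principal vertices, of a non-vanishing monomial that respects the exponent bounds and avoids
  \<open>v\<^sub>1\<close>. Every component admits \<open>(c, d) = (0, 1)\<close> and \<open>(1, 0)\<close>, and an even wheel admits
  \<open>(0, 0)\<close>. At a glued edge \<open>v\<^sub>1 x\<close> the polynomials are multiplied together with the factor
  \<open>x - v\<^sub>1\<close>. Since they share only the variables \<open>x\<close> and \<open>v\<^sub>1\<close>, and the
  latter does not occur in the monomials considered, homogeneity determines how an exponent of \<open>x\<close>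
  splits between the two sides, so no cancellation is possible. Using \<open>(0, 1)\<close> on one side
  of an even wheel and \<open>(1, 0)\<close> on the other, every glued vertex receives exponent exactly
  \<open>2\<close>.

  For a single component, the product over a path and the spokes from a hub to it is
  multiplied out from one end of the path: the exponent \<open>0\<close>, \<open>1\<close> or \<open>2\<close> of the first path vertex
  leaves at most two choices, which gives a two-term recursion for the coefficients.
\<close>

section \<open>Homogeneous polynomials and unique factorization of monomials\<close>

definition mdeg :: "('a \<Rightarrow>\<^sub>0 nat) \<Rightarrow> nat" where
  "mdeg m = (\<Sum>v\<in>Poly_Mapping.keys m. Poly_Mapping.lookup m v)"

text \<open>Variables and degree are recorded together, since the gluing argument needs both. The
  zero polynomial is homogeneous of every degree.\<close>

definition homog :: "'a set \<Rightarrow> nat \<Rightarrow> (('a \<Rightarrow>\<^sub>0 nat) \<Rightarrow>\<^sub>0 int) \<Rightarrow> bool" where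
  "homog V d p \<longleftrightarrow>
     (\<forall>k\<in>Poly_Mapping.keys p. Poly_Mapping.keys k \<subseteq> V \<and> mdeg k = d)"

lemma mdeg_superset:
  assumes "finite A" "Poly_Mapping.keys m \<subseteq> A"
  shows "mdeg m = (\<Sum>v\<in>A. Poly_Mapping.lookup m v)"
  unfolding mdeg_def
  by (rule sum.mono_neutral_left) (use assms in \<open>auto simp: in_keys_iff\<close>)

lemma mdeg_add: "mdeg (k + l) = mdeg k + mdeg l"
proof -
  let ?A = "Poly_Mapping.keys k \<union> Poly_Mapping.keys l"
  have "mdeg (k + l) = (\<Sum>v\<in>?A. Poly_Mapping.lookup (k + l) v)"
    using keys_add[of k l] by (intro mdeg_superset) auto
  also have "\<dots> = mdeg k + mdeg l"
    by (simp add: mdeg_superset[of ?A k] mdeg_superset[of ?A l] lookup_add sum.distrib)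
  finally show ?thesis .
qed

lemma homog_mult:
  assumes "homog V d p" "homog V e q"
  shows "homog V (d + e) (p * q)"
  unfolding homog_def
proof
  fix k assume "k \<in> Poly_Mapping.keys (p * q)"
  then obtain a b where "k = a + b" "a \<in> Poly_Mapping.keys p" "b \<in> Poly_Mapping.keys q"
    using keys_mult[of p q] by blast
  with assms show "Poly_Mapping.keys k \<subseteq> V \<and> mdeg k = d + e"
    using keys_add[of a b] by (force simp: homog_def mdeg_add)
qed

lemma homog_one: "homog V 0 1"
  by (auto simp: homog_def mdeg_def)

lemma homog_diff_Var:
  assumes "u \<in> V" "v \<in> V"
  shows "homog V 1 (Var u - Var v)"
proof -
  have "Poly_Mapping.keys (Var u - Var v)
      \<subseteq> {Poly_Mapping.single u 1, Poly_Mapping.single v 1}"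
    using keys_diff[of "Var u" "Var v"] by (auto simp: Var_def)
  with assms show ?thesis
    by (fastforce simp: homog_def mdeg_def)
qed

lemma homog_prod:
  assumes "finite S" "\<And>s. s \<in> S \<Longrightarrow> homog V 1 (f s)"
  shows "homog V (card S) (prod f S)"
  using assms
proof (induction S rule: finite_induct)
  case empty
  then show ?case by (simp add: homog_one)
next
  case (insert s S)
  then show ?case using homog_mult[of V 1 "f s" "card S" "prod f S"] by simp
qed

text \<open>With the terms at \<open>a\<close> and \<open>b\<close> split off, \<open>p'\<close> and
  \<open>q'\<close> remain. Neither \<open>p' * q\<close> nor the \<open>a\<close>-term times
  \<open>q'\<close> reaches \<open>a + b\<close>: the first by the assumption, the second by
  cancelling \<open>a\<close>. Hence uniqueness needs to be asked for in the first factor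
  only.\<close>

lemma lookup_mult_unique:
  fixes p q :: "('a \<Rightarrow>\<^sub>0 nat) \<Rightarrow>\<^sub>0 int"
  assumes "\<And>k l. k \<in> Poly_Mapping.keys p \<Longrightarrow> l \<in> Poly_Mapping.keys q \<Longrightarrow>
             k + l = a + b \<Longrightarrow> k = a"
  shows "Poly_Mapping.lookup (p * q) (a + b)
       = Poly_Mapping.lookup p a * Poly_Mapping.lookup q b"
proof -
  define p' where "p' = p - Poly_Mapping.single a (Poly_Mapping.lookup p a)"
  define q' where "q' = q - Poly_Mapping.single b (Poly_Mapping.lookup q b)"
  have a: "a \<notin> Poly_Mapping.keys p'" and b: "b \<notin> Poly_Mapping.keys q'"
    by (simp_all add: in_keys_iff p'_def q'_def lookup_minus)
  have p': "k \<in> Poly_Mapping.keys p" if "k \<in> Poly_Mapping.keys p'" for k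
    using that a
    by (cases "k = a") (auto simp: in_keys_iff p'_def lookup_minus lookup_single)
  have "a + b \<notin> Poly_Mapping.keys (p' * q)"
    using keys_mult[of p' q] assms p' a by fastforce
  then have 1: "Poly_Mapping.lookup (p' * q) (a + b) = 0"
    by (simp add: in_keys_iff)
  have "a + b \<notin> Poly_Mapping.keys (Poly_Mapping.single a (Poly_Mapping.lookup p a) * q')"
    using keys_mult[of "Poly_Mapping.single a (Poly_Mapping.lookup p a)" q'] b
    by (fastforce split: if_splits)
  then have 2: "Poly_Mapping.lookup
      (Poly_Mapping.single a (Poly_Mapping.lookup p a) * q') (a + b) = 0"
    by (simp add: in_keys_iff)
  have "p * q = Poly_Mapping.single a (Poly_Mapping.lookup p a)
                  * Poly_Mapping.single b (Poly_Mapping.lookup q b)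
              + Poly_Mapping.single a (Poly_Mapping.lookup p a) * q' + p' * q"
    by (simp add: p'_def q'_def algebra_simps)
  then show ?thesis
    using 1 2 by (simp add: mult_single lookup_add)
qed

text \<open>Subtraction of exponents is truncated, so \<open>m - Poly_Mapping.single v 1\<close>
  would be \<open>m\<close> itself if \<open>v\<close> did not occur in \<open>m\<close>; hence the
  case distinction.\<close>

lemma lookup_Var_mult:
  "Poly_Mapping.lookup (Var v * p) m =
     (if Poly_Mapping.lookup m v = 0 then 0
      else Poly_Mapping.lookup p (m - Poly_Mapping.single v 1))"
proof (cases "Poly_Mapping.lookup m v = 0")
  case True
  have "m \<notin> Poly_Mapping.keys (Var v * p)"
  proof
    assume "m \<in> Poly_Mapping.keys (Var v * p)"
    then obtain a b where "m = a + b" "a \<in> Poly_Mapping.keys (Var v)"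
      using keys_mult[of "Var v" p] by blast
    then have "m = Poly_Mapping.single v 1 + b" by (simp add: Var_def)
    with True show False by (simp add: lookup_add)
  qed
  with True show ?thesis by (simp add: in_keys_iff)
next
  case False
  have m: "m = Poly_Mapping.single v 1 + (m - Poly_Mapping.single v 1)"
    using False
    by (intro poly_mapping_eqI) (auto simp: lookup_add lookup_minus lookup_single when_def)
  have "Poly_Mapping.lookup (Var v * p) m
      = Poly_Mapping.lookup (Var v) (Poly_Mapping.single v 1)
        * Poly_Mapping.lookup p (m - Poly_Mapping.single v 1)"
    by (subst m, rule lookup_mult_unique) (simp add: Var_def)
  with False show ?thesis by (simp add: Var_def)
qed

text \<open>A monomial free of \<open>w\<close> can only use the summand \<open>Var v\<close> of the
  factor. This is how a single edge at a vertex of exponent \<open>0\<close> is added to a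
  polynomial.\<close>

lemma lookup_diff_Var_mult:
  assumes "Poly_Mapping.lookup m w = 0"
  shows "Poly_Mapping.lookup ((Var v - Var w) * p) (Poly_Mapping.single v 1 + m)
       = (if v = w then 0 else Poly_Mapping.lookup p m)"
  using assms
  by (auto simp: left_diff_distrib lookup_minus lookup_Var_mult lookup_add lookup_single when_def)

lemma lookup_mult_glue:
  assumes p: "homog V d p" and q: "homog W e q" and VW: "V \<inter> W \<subseteq> {v, x}"
    and pa: "Poly_Mapping.lookup p a \<noteq> 0" and qb: "Poly_Mapping.lookup q b \<noteq> 0"
    and v: "Poly_Mapping.lookup a v = 0" "Poly_Mapping.lookup b v = 0"
  shows "Poly_Mapping.lookup (p * q) (a + b) \<noteq> 0"
proof -
  have a: "Poly_Mapping.keys a \<subseteq> V" "mdeg a = d" and b: "Poly_Mapping.keys b \<subseteq> W"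
    using p q pa qb by (auto simp: homog_def in_keys_iff)
  have "k = a" if k: "k \<in> Poly_Mapping.keys p" and l: "l \<in> Poly_Mapping.keys q"
    and kl: "k + l = a + b" for k l
  proof -
    have k': "Poly_Mapping.keys k \<subseteq> V" "mdeg k = d" and l': "Poly_Mapping.keys l \<subseteq> W"
      using p q k l unfolding homog_def by blast+
    have sum: "Poly_Mapping.lookup k z + Poly_Mapping.lookup l z
        = Poly_Mapping.lookup a z + Poly_Mapping.lookup b z" for z
      using arg_cong[OF kl, of "\<lambda>k. Poly_Mapping.lookup k z"] by (simp add: lookup_add)
    \<comment> \<open>The exponent of \<open>z\<close> can split in one way only: it is
      \<open>0\<close> in total for \<open>v\<close>, and any other variable except \<open>x\<close>
      belongs to at most one of \<open>V\<close> and \<open>W\<close>.\<close>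
    have off: "Poly_Mapping.lookup k z = Poly_Mapping.lookup a z" if "z \<noteq> x" for z
    proof -
      consider "z = v" | "z \<notin> V" | "z \<notin> W" using VW \<open>z \<noteq> x\<close> by blast
      then show ?thesis
      proof cases
        case 1
        then show ?thesis using sum[of v] v by simp
      next
        case 2
        then have "Poly_Mapping.lookup k z = 0" "Poly_Mapping.lookup a z = 0"
          using a k' by (auto simp: in_keys_iff subset_iff)
        then show ?thesis by simp
      next
        case 3
        then have "Poly_Mapping.lookup l z = 0" "Poly_Mapping.lookup b z = 0"
          using b l' by (auto simp: in_keys_iff subset_iff)
        then show ?thesis using sum[of z] by simp
      qed
    qed
    \<comment> \<open>Both \<open>k\<close> and \<open>a\<close> are monomials of degree
      \<open>d\<close>, so agreement away from \<open>x\<close> forces agreement at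
      \<open>x\<close>.\<close>
    let ?A = "insert x (Poly_Mapping.keys k \<union> Poly_Mapping.keys a)"
    have "(\<Sum>z\<in>?A. Poly_Mapping.lookup k z) = (\<Sum>z\<in>?A. Poly_Mapping.lookup a z)"
      using a k' mdeg_superset[of ?A k] mdeg_superset[of ?A a]
      by (simp add: subset_insertI2)
    moreover have "(\<Sum>z\<in>?A - {x}. Poly_Mapping.lookup k z)
        = (\<Sum>z\<in>?A - {x}. Poly_Mapping.lookup a z)"
      by (intro sum.cong) (auto simp: off)
    ultimately have "Poly_Mapping.lookup k x = Poly_Mapping.lookup a x"
      by (simp add: sum.remove[of ?A x])
    with off show "k = a" by (intro poly_mapping_eqI) (metis off)
  qed
  then show ?thesis using lookup_mult_unique[of p q a b] pa qb by simp
qed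

section \<open>Fan polynomials\<close>

text \<open>The product over a path \<open>ws\<close> and all spokes from the hub \<open>h\<close>
  to it, in one fixed orientation. In the last equation the first path vertex occurs in exactly two
  factors if all vertices are distinct.\<close>

fun fan :: "'a \<Rightarrow> 'a list \<Rightarrow> ('a \<Rightarrow>\<^sub>0 nat) \<Rightarrow>\<^sub>0 int" where
  "fan h [] = 1"
| "fan h [w] = Var h - Var w"
| "fan h (w # w' # ws) = (Var w - Var w') * ((Var h - Var w) * fan h (w' # ws))"

lemma homog_fan: "\<exists>d. homog (insert h (set ws)) d (fan h ws)"
proof -
  \<comment> \<open>The variable set is generalized so that it can stay fixed while the path gets
    shorter.\<close>
  have "\<exists>d. homog V d (fan h ws)" if "insert h (set ws) \<subseteq> V" for V
    using that
  proof (induction h ws rule: fan.induct)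
    case (1 h)
    then show ?case using homog_one by fastforce
  next
    case (2 h w)
    then have "homog V 1 (fan h [w])" using homog_diff_Var[of h V w] by simp
    then show ?case by blast
  next
    case (3 h w w' ws)
    then obtain d where "homog V d (fan h (w' # ws))" by auto
    then have "homog V (1 + (1 + d)) (fan h (w # w' # ws))"
      unfolding fan.simps using 3 by (intro homog_mult homog_diff_Var) auto
    then show ?case by blast
  qed
  then show ?thesis by blast
qed

lemma lookup_fan_outside:
  assumes "z \<notin> insert h (set ws)" "Poly_Mapping.lookup m z \<noteq> 0"
  shows "Poly_Mapping.lookup (fan h ws) m = 0"
  using homog_fan[of h ws] assms unfolding homog_def by (meson in_keys_iff subsetD)

text \<open>The path is \<open>w # ws @ [x]\<close>, with \<open>e\<close> and \<open>f\<close> the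
  exponents at its ends and \<open>a\<close> the one at the hub. A predicate instead of an explicit
  monomial lets shifted monomials be recognized one exponent at a time.\<close>

definition fan_exponents ::
    "'a \<Rightarrow> 'a \<Rightarrow> 'a list \<Rightarrow> 'a \<Rightarrow> nat \<Rightarrow> nat \<Rightarrow> nat \<Rightarrow> ('a \<Rightarrow>\<^sub>0 nat) \<Rightarrow> bool" where
  "fan_exponents h w ws x e f a m \<longleftrightarrow>
     Poly_Mapping.lookup m h = a \<and> Poly_Mapping.lookup m w = e \<and>
     Poly_Mapping.lookup m x = f \<and> (\<forall>z\<in>set ws. Poly_Mapping.lookup m z = 2) \<and>
     (\<forall>z. z \<notin> insert h (set (w # ws @ [x])) \<longrightarrow> Poly_Mapping.lookup m z = 0)"

text \<open>The vertex \<open>w\<close> occurs only in \<open>(w - w') * (h - w)\<close>, which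
  expands to \<open>w*h - w^2 - w'*h + w'*w\<close>. The exponent of \<open>w\<close> selects the
  terms that can contribute: \<open>- w'*h\<close> for \<open>0\<close>, \<open>w*h\<close> and
  \<open>w'*w\<close> for \<open>1\<close>, \<open>- w^2\<close> for \<open>2\<close>.\<close>

lemma lookup_fan_Cons:
  assumes "distinct (h # w # w' # ws)"
  shows "Poly_Mapping.lookup m w = 0 \<Longrightarrow>
           Poly_Mapping.lookup (fan h (w # w' # ws)) m =
             - (if Poly_Mapping.lookup m w' = 0 \<or> Poly_Mapping.lookup m h = 0 then 0
                else Poly_Mapping.lookup (fan h (w' # ws))
                  (m - Poly_Mapping.single w' 1 - Poly_Mapping.single h 1))"
    and "Poly_Mapping.lookup m w = 1 \<Longrightarrow>
           Poly_Mapping.lookup (fan h (w # w' # ws)) m =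
             (if Poly_Mapping.lookup m h = 0 then 0
              else Poly_Mapping.lookup (fan h (w' # ws))
                (m - Poly_Mapping.single w 1 - Poly_Mapping.single h 1))
           + (if Poly_Mapping.lookup m w' = 0 then 0
              else Poly_Mapping.lookup (fan h (w' # ws))
                (m - Poly_Mapping.single w' 1 - Poly_Mapping.single w 1))"
    and "Poly_Mapping.lookup m w = 2 \<Longrightarrow>
           Poly_Mapping.lookup (fan h (w # w' # ws)) m =
             - Poly_Mapping.lookup (fan h (w' # ws))
                (m - Poly_Mapping.single w 1 - Poly_Mapping.single w 1)"
proof -
  have out: "Poly_Mapping.lookup (fan h (w' # ws)) k = 0" if "Poly_Mapping.lookup k w \<noteq> 0" for k
    using lookup_fan_outside[of w h "w' # ws" k] that assms by auto
  note [simp] = left_diff_distrib lookup_minus lookup_Var_mult lookup_single when_def out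
  {
    assume "Poly_Mapping.lookup m w = 0"
    then show "Poly_Mapping.lookup (fan h (w # w' # ws)) m =
             - (if Poly_Mapping.lookup m w' = 0 \<or> Poly_Mapping.lookup m h = 0 then 0
                else Poly_Mapping.lookup (fan h (w' # ws))
                  (m - Poly_Mapping.single w' 1 - Poly_Mapping.single h 1))"
      using assms by auto
  next
    assume "Poly_Mapping.lookup m w = 1"
    then show "Poly_Mapping.lookup (fan h (w # w' # ws)) m =
             (if Poly_Mapping.lookup m h = 0 then 0
              else Poly_Mapping.lookup (fan h (w' # ws))
                (m - Poly_Mapping.single w 1 - Poly_Mapping.single h 1))
           + (if Poly_Mapping.lookup m w' = 0 then 0
              else Poly_Mapping.lookup (fan h (w' # ws))
                (m - Poly_Mapping.single w' 1 - Poly_Mapping.single w 1))"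
      using assms by auto
  next
    assume "Poly_Mapping.lookup m w = 2"
    then show "Poly_Mapping.lookup (fan h (w # w' # ws)) m =
             - Poly_Mapping.lookup (fan h (w' # ws))
                (m - Poly_Mapping.single w 1 - Poly_Mapping.single w 1)"
      using assms by auto
  }
qed

lemma lookup_fan_single:
  assumes "h \<noteq> x" "\<And>z. z \<notin> {h, x} \<Longrightarrow> Poly_Mapping.lookup m z = 0"
  shows "Poly_Mapping.lookup (fan h [x]) m =
    (if Poly_Mapping.lookup m h = 1 \<and> Poly_Mapping.lookup m x = 0 then 1
     else if Poly_Mapping.lookup m h = 0 \<and> Poly_Mapping.lookup m x = 1 then -1 else 0)"
proof -
  have eq: "Poly_Mapping.single y 1 = m \<longleftrightarrow> Poly_Mapping.lookup m y = 1 \<and>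
      (\<forall>z. z \<noteq> y \<longrightarrow> Poly_Mapping.lookup m z = 0)" for y
    by (auto simp: poly_mapping_eq_iff fun_eq_iff lookup_single when_def)
  have "(\<forall>z. z \<noteq> h \<longrightarrow> Poly_Mapping.lookup m z = 0) \<longleftrightarrow> Poly_Mapping.lookup m x = 0"
    "(\<forall>z. z \<noteq> x \<longrightarrow> Poly_Mapping.lookup m z = 0) \<longleftrightarrow> Poly_Mapping.lookup m h = 0"
    using assms by (auto, metis)
  then show ?thesis
    unfolding fan.simps lookup_minus Var_def lookup_single eq when_def by auto
qed

lemma fan_exponents_simps:
  assumes "distinct (h # w # ws @ [x])" "fan_exponents h w ws x e f a m"
  shows "Poly_Mapping.lookup m h = a" "Poly_Mapping.lookup m w = e"
    "Poly_Mapping.lookup m x = f" "\<And>z. z \<in> set ws \<Longrightarrow> Poly_Mapping.lookup m z = 2"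
    "\<And>z. z \<noteq> h \<Longrightarrow> z \<noteq> w \<Longrightarrow> z \<noteq> x \<Longrightarrow> z \<notin> set ws \<Longrightarrow> Poly_Mapping.lookup m z = 0"
  using assms by (auto simp: fan_exponents_def)

text \<open>Once \<open>w\<close> is stripped, \<open>w'\<close> turns from an inner vertex into the
  first one, so its exponent need no longer be \<open>2\<close>. The monomial \<open>k\<close>
  stands for any of the shifted monomials of the recursion.\<close>

lemma fan_exponents_tl:
  assumes d: "distinct (h # w # w' # ws @ [x])" and m: "fan_exponents h w (w' # ws) x e f a m"
    and k: "Poly_Mapping.lookup k h = a'" "Poly_Mapping.lookup k w' = e'"
    "Poly_Mapping.lookup k w = 0"
    "\<And>z. z \<notin> {h, w, w'} \<Longrightarrow> Poly_Mapping.lookup k z = Poly_Mapping.lookup m z"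
  shows "fan_exponents h w' ws x e' f a' k"
  unfolding fan_exponents_def
proof (intro conjI ballI allI impI)
  show "Poly_Mapping.lookup k x = f"
    using k(4)[of x] m d by (auto simp: fan_exponents_def)
  show "Poly_Mapping.lookup k z = 2" if "z \<in> set ws" for z
    using that k(4)[of z] m d by (auto simp: fan_exponents_def)
  show "Poly_Mapping.lookup k z = 0" if "z \<notin> insert h (set (w' # ws @ [x]))" for z
  proof (cases "z = w")
    case True
    then show ?thesis using k(3) by simp
  next
    case False
    then show ?thesis using that k(4)[of z] m by (auto simp: fan_exponents_def)
  qed
qed (use k in auto)

text \<open>
  The coefficient in the fan with \<open>n\<close> inner path vertices of the monomial with exponent \<open>e\<close> at the
  first and \<open>f\<close> at the last path vertex, \<open>2\<close> at the inner ones, and \<open>3 - e - f\<close> at the hub.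
\<close>

definition fan_value :: "nat \<Rightarrow> nat \<Rightarrow> nat \<Rightarrow> int" where
  "fan_value n f e =
     (if f = 0 then
        (if e = 0 then (if even n then 0 else -1)
         else if e = 1 then (if even n then 1 else 0)
         else (if even n then -1 else 1))
      else if f = 1 then
        (if e = 0 then (if even n then -1 else 0)
         else if e = 1 then (if even n then 0 else 1)
         else (if even n then 1 else -1))
      else (if e = 0 then 1 else -1))"

text \<open>With \<open>n\<close> inner vertices the fan has degree \<open>2 * n + 3\<close>, which
  leaves \<open>3\<close> for \<open>e + f + a\<close>. Stripping the first path vertex turns
  \<open>e = 0\<close> into \<open>- fan_value n f 1\<close>, \<open>e = 1\<close> into
  \<open>fan_value n f 2 + fan_value n f 1\<close>, and \<open>e = 2\<close> into
  \<open>- fan_value n f 2\<close>.\<close>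

lemma lookup_fan:
  assumes "distinct (h # w # ws @ [x])" "fan_exponents h w ws x e f a m"
    and "e \<le> 2" "f \<le> 2" "e + f + a = 3"
  shows "Poly_Mapping.lookup (fan h (w # ws @ [x])) m = fan_value (length ws) f e"
  using assms
proof (induction ws arbitrary: w m e a)
  case Nil
  note m = fan_exponents_simps[OF Nil(1,2)]
  have d: "distinct (h # w # x # [])" using Nil by simp
  have s: "Poly_Mapping.lookup (fan h [x]) k =
    (if Poly_Mapping.lookup k h = 1 \<and> Poly_Mapping.lookup k x = 0 then 1
     else if Poly_Mapping.lookup k h = 0 \<and> Poly_Mapping.lookup k x = 1 then -1 else 0)"
    if "\<And>z. z \<notin> {h, x} \<Longrightarrow> Poly_Mapping.lookup k z = 0" for k
    by (rule lookup_fan_single) (use d that in auto)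
  have n: "h \<noteq> w" "h \<noteq> x" "w \<noteq> x" "w \<noteq> h" "x \<noteq> h" "x \<noteq> w" using d by auto
  have m0: "Poly_Mapping.lookup m z = 0" if "z \<noteq> h" "z \<noteq> w" "z \<noteq> x" for z
    using m(5) that by simp
  have ef: "(e, f, a) \<in> {(0,0,3),(0,1,2),(0,2,1),(1,0,2),(1,1,1),(1,2,0),(2,0,1),(2,1,0)}"
  proof -
    have "e = 0 \<or> e = 1 \<or> e = 2" "f = 0 \<or> f = 1 \<or> f = 2"
      using Nil.prems(3,4) by linarith+
    then show ?thesis using Nil.prems(5) by (elim disjE) simp_all
  qed
  show ?case
  proof (cases "e = 0")
    case True
    then have "Poly_Mapping.lookup m z = 0" if "z \<notin> {h, x}" for z
      using m0[of z] m(2) that by (cases "z = w") auto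
    then have "Poly_Mapping.lookup (m - Poly_Mapping.single x 1 - Poly_Mapping.single h 1) z = 0"
      if "z \<notin> {h, x}" for z
      using that by (simp add: lookup_minus)
    from s[OF this] show ?thesis
      using lookup_fan_Cons(1)[OF d, of m] m(1-3) n ef True
      by (auto simp: lookup_minus lookup_single when_def fan_value_def simp del: fan.simps)
  next
    case False
    show ?thesis
    proof (cases "e = 1")
      case True
      then have "Poly_Mapping.lookup (m - Poly_Mapping.single w 1 - Poly_Mapping.single h 1) z = 0"
        "Poly_Mapping.lookup (m - Poly_Mapping.single x 1 - Poly_Mapping.single w 1) z = 0"
        if "z \<notin> {h, x}" for z
        using that m0[of z] m(2) n
        by (cases "z = w"; simp add: lookup_minus lookup_single when_def)+
      from s[OF this(1)] s[OF this(2)] show ?thesis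
        using lookup_fan_Cons(2)[OF d, of m] m(1-3) n ef True
        by (auto simp: lookup_minus lookup_single when_def fan_value_def simp del: fan.simps)
    next
      case False
      with \<open>e \<noteq> 0\<close> have e: "e = 2" using ef by auto
      then have "Poly_Mapping.lookup (m - Poly_Mapping.single w 1 - Poly_Mapping.single w 1) z = 0"
        if "z \<notin> {h, x}" for z
        using that m0[of z] m(2) n
        by (cases "z = w"; simp add: lookup_minus lookup_single when_def)
      from s[OF this] show ?thesis
        using lookup_fan_Cons(3)[OF d, of m] m(1-3) n ef e
        by (auto simp: lookup_minus lookup_single when_def fan_value_def simp del: fan.simps)
    qed
  qed
next
  case (Cons w' ws)
  note m = fan_exponents_simps[OF Cons.prems(1,2)]
  have d: "distinct (h # w # w' # ws @ [x])" using Cons.prems by simp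
  have d': "distinct (h # w' # ws @ [x])" using d by simp
  have m': "Poly_Mapping.lookup m w' = 2" using m by simp
  have n: "h \<noteq> w" "h \<noteq> x" "w \<noteq> x" "w \<noteq> h" "x \<noteq> h" "x \<noteq> w" "w' \<noteq> w" "w' \<noteq> x" "w' \<noteq> h"
    "w \<noteq> w'" "x \<noteq> w'" "h \<noteq> w'" "h \<notin> set ws" "w \<notin> set ws" "x \<notin> set ws" "w' \<notin> set ws"
    using d by auto
  note exps = fan_exponents_def lookup_minus lookup_single when_def
  note IH = Cons.IH[OF d' _ _ \<open>f \<le> 2\<close>]
  consider "e = 0" | "e = 1" | "e = 2" using Cons.prems(3) by linarith
  then show ?case
  proof cases
    case 1
    have "fan_exponents h w' ws x 1 f (a - 1)
        (m - Poly_Mapping.single w' 1 - Poly_Mapping.single h 1)"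
      by (rule fan_exponents_tl[OF d Cons.prems(2)]) (use m m' n 1 in \<open>auto simp: exps\<close>)
    then have "Poly_Mapping.lookup (fan h (w' # ws @ [x]))
        (m - Poly_Mapping.single w' 1 - Poly_Mapping.single h 1) = fan_value (length ws) f 1"
      by (rule IH) (use Cons.prems 1 in auto)
    then show ?thesis
      using lookup_fan_Cons(1)[OF d, of m] m(1,2) m' 1 Cons.prems(3-5)
      by (simp add: fan_value_def split: if_splits)
  next
    case 2
    \<comment> \<open>This term takes \<open>h\<close> from the spoke, so it is absent when the hub
      exponent is \<open>0\<close>, which for \<open>e = 1\<close> means
      \<open>f = 2\<close>.\<close>
    have "Poly_Mapping.lookup (fan h (w' # ws @ [x]))
        (m - Poly_Mapping.single w 1 - Poly_Mapping.single h 1) = fan_value (length ws) f 2"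
      if "a \<noteq> 0"
    proof (rule IH)
      show "fan_exponents h w' ws x 2 f (a - 1)
          (m - Poly_Mapping.single w 1 - Poly_Mapping.single h 1)"
        by (rule fan_exponents_tl[OF d Cons.prems(2)]) (use m m' n 2 in \<open>auto simp: exps\<close>)
    qed (use Cons.prems 2 that in auto)
    moreover have "Poly_Mapping.lookup (fan h (w' # ws @ [x]))
        (m - Poly_Mapping.single w' 1 - Poly_Mapping.single w 1) = fan_value (length ws) f 1"
    proof (rule IH)
      show "fan_exponents h w' ws x 1 f a
          (m - Poly_Mapping.single w' 1 - Poly_Mapping.single w 1)"
        by (rule fan_exponents_tl[OF d Cons.prems(2)]) (use m m' n 2 in \<open>auto simp: exps\<close>)
    qed (use Cons.prems 2 in auto)
    ultimately show ?thesis
      using lookup_fan_Cons(2)[OF d, of m] m(1,2) m' 2 Cons.prems(3-5)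
      by (simp add: fan_value_def split: if_splits)
  next
    case 3
    have "fan_exponents h w' ws x 2 f a
        (m - Poly_Mapping.single w 1 - Poly_Mapping.single w 1)"
      by (rule fan_exponents_tl[OF d Cons.prems(2)]) (use m m' n 3 in \<open>auto simp: exps\<close>)
    then have "Poly_Mapping.lookup (fan h (w' # ws @ [x]))
        (m - Poly_Mapping.single w 1 - Poly_Mapping.single w 1) = fan_value (length ws) f 2"
      by (rule IH) (use Cons.prems 3 in auto)
    then show ?thesis
      using lookup_fan_Cons(3)[OF d, of m] m(1,2) m' 3 Cons.prems(3-5)
      by (simp add: fan_value_def split: if_splits)
  qed
qed

lemma ex_fan_exponents:
  assumes "distinct (h # w # ws @ [x])"
  shows "\<exists>m. fan_exponents h w ws x e f a m"
proof
  show "fan_exponents h w ws x e f a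
    (Poly_Mapping.single h a + Poly_Mapping.single w e + Poly_Mapping.single x f
     + (\<Sum>z\<in>set ws. Poly_Mapping.single z 2))"
    using assms
    by (auto simp: fan_exponents_def lookup_add lookup_single lookup_sum when_def)
qed

section \<open>Graph polynomials up to sign\<close>

text \<open>Reorienting an edge flips the sign of its factor, and non-vanishing does not depend on
  the sign. Working up to sign allows a convenient orientation to be chosen for each edge.\<close>

definition up_to_sign :: "(('a \<Rightarrow>\<^sub>0 nat) \<Rightarrow>\<^sub>0 int) \<Rightarrow> (('a \<Rightarrow>\<^sub>0 nat) \<Rightarrow>\<^sub>0 int) \<Rightarrow> bool" where
  "up_to_sign p q \<longleftrightarrow> p = q \<or> p = - q"

lemma up_to_sign_refl [simp]: "up_to_sign p p"
  by (simp add: up_to_sign_def)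

lemma up_to_sign_trans: "up_to_sign p q \<Longrightarrow> up_to_sign q r \<Longrightarrow> up_to_sign p r"
  by (auto simp: up_to_sign_def)

lemma up_to_sign_mult:
  "up_to_sign p p' \<Longrightarrow> up_to_sign q q' \<Longrightarrow> up_to_sign (p * q) (p' * q')"
  by (auto simp: up_to_sign_def)

lemma up_to_sign_lookup:
  "up_to_sign p q \<Longrightarrow> Poly_Mapping.lookup p m \<noteq> 0 \<longleftrightarrow> Poly_Mapping.lookup q m \<noteq> 0"
  by (auto simp: up_to_sign_def)

definition arcs :: "('a \<Rightarrow> 'a \<Rightarrow> bool) \<Rightarrow> 'a set set \<Rightarrow> ('a \<times> 'a) set" where
  "arcs lt E = {(u, v). {u, v} \<in> E \<and> lt u v}"

text \<open>The graph polynomial as a function of the edge set alone, so that edges can be split off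
  and edge sets joined without building graphs.\<close>

definition edge_poly :: "('a \<Rightarrow> 'a \<Rightarrow> bool) \<Rightarrow> 'a set set \<Rightarrow> ('a \<Rightarrow>\<^sub>0 nat) \<Rightarrow>\<^sub>0 int" where
  "edge_poly lt E = (\<Prod>(u, v)\<in>arcs lt E. Var u - Var v)"

definition oriented :: "('a \<Rightarrow> 'a \<Rightarrow> bool) \<Rightarrow> 'a set set \<Rightarrow> bool" where
  "oriented lt E \<longleftrightarrow> (\<forall>u v. {u, v} \<in> E \<longrightarrow> (lt u v \<longleftrightarrow> \<not> lt v u))"

lemma orientedD: "oriented lt E \<Longrightarrow> {u, v} \<in> E \<Longrightarrow> lt u v \<longleftrightarrow> \<not> lt v u"
  unfolding oriented_def by blast

lemma oriented_subset: "oriented lt E \<Longrightarrow> F \<subseteq> E \<Longrightarrow> oriented lt F"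
  unfolding oriented_def by blast

text \<open>Exactly one direction of each edge is chosen, so mapping arcs to edges is
  injective.\<close>

lemma finite_arcs:
  assumes "oriented lt E" "finite E"
  shows "finite (arcs lt E)"
proof (rule finite_imageD)
  show "finite ((\<lambda>(u, v). {u, v}) ` arcs lt E)"
    by (rule finite_subset[OF _ assms(2)]) (auto simp: arcs_def)
  show "inj_on (\<lambda>(u, v). {u, v}) (arcs lt E)"
  proof (rule inj_onI)
    fix p q assume "p \<in> arcs lt E" "q \<in> arcs lt E"
      and eq: "(case p of (u, v) \<Rightarrow> {u, v}) = (case q of (u, v) \<Rightarrow> {u, v})"
    then obtain u v u' v' where p: "p = (u, v)" and q: "q = (u', v')"
      and e: "{u, v} \<in> E" "lt u v" "lt u' v'"
      by (auto simp: arcs_def)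
    have "\<not> lt v u" using orientedD[OF assms(1) e(1)] e(2) by blast
    then show "p = q" using eq e p q by (auto simp: doubleton_eq_iff)
  qed
qed

lemma edge_poly_empty [simp]: "edge_poly lt {} = 1"
  by (simp add: edge_poly_def arcs_def)

lemma edge_poly_Un:
  assumes "oriented lt (E \<union> F)" "finite E" "finite F" "E \<inter> F = {}"
  shows "edge_poly lt (E \<union> F) = edge_poly lt E * edge_poly lt F"
proof -
  have "arcs lt (E \<union> F) = arcs lt E \<union> arcs lt F" "arcs lt E \<inter> arcs lt F = {}"
    using assms(4) by (auto simp: arcs_def)
  moreover have "finite (arcs lt E)" "finite (arcs lt F)"
    using assms by (auto intro: finite_arcs oriented_subset)
  ultimately show ?thesis
    by (simp add: edge_poly_def prod.union_disjoint)
qed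

lemma edge_poly_single:
  assumes "oriented lt {{a, b}}"
  shows "up_to_sign (edge_poly lt {{a, b}}) (Var a - Var b)"
proof -
  have ab: "lt a b \<longleftrightarrow> \<not> lt b a" using orientedD[OF assms] by blast
  have "arcs lt {{a, b}} = (if lt a b then {(a, b)} else {(b, a)})"
    using ab by (auto simp: arcs_def doubleton_eq_iff)
  then show ?thesis by (simp add: edge_poly_def up_to_sign_def)
qed

lemma edge_poly_insert:
  assumes "oriented lt (insert {a, b} E)" "finite E" "{a, b} \<notin> E"
  shows "up_to_sign (edge_poly lt (insert {a, b} E)) ((Var a - Var b) * edge_poly lt E)"
proof -
  have "edge_poly lt ({{a, b}} \<union> E) = edge_poly lt {{a, b}} * edge_poly lt E"
    using assms by (intro edge_poly_Un) auto
  moreover have "up_to_sign (edge_poly lt {{a, b}}) (Var a - Var b)"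
    using assms by (intro edge_poly_single) (auto intro: oriented_subset)
  ultimately show ?thesis by (simp add: up_to_sign_mult)
qed

lemma homog_edge_poly:
  assumes "oriented lt E" "finite E" "\<And>e. e \<in> E \<Longrightarrow> e \<subseteq> V"
  shows "homog V (card (arcs lt E)) (edge_poly lt E)"
  unfolding edge_poly_def
proof (rule homog_prod)
  show "finite (arcs lt E)" using assms by (intro finite_arcs)
  show "homog V 1 (case s of (u, v) \<Rightarrow> Var u - Var v)" if "s \<in> arcs lt E" for s
    using that assms(3) homog_diff_Var[of "fst s" V "snd s"]
    by (fastforce simp: arcs_def split: prod.splits)
qed

section \<open>Edge sets of paths and fans\<close>

lemma path_edges_Cons [simp]:
  "path_edges [] = {}" "path_edges [a] = {}"
  "path_edges (a # b # xs) = insert {a, b} (path_edges (b # xs))"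
proof -
  show "path_edges (a # b # xs) = insert {a, b} (path_edges (b # xs))" (is "?L = ?R")
  proof
    show "?L \<subseteq> ?R"
    proof
      fix e assume "e \<in> ?L"
      then obtain i where i: "e = {(a # b # xs) ! i, (a # b # xs) ! Suc i}"
        "Suc i < length (a # b # xs)"
        unfolding path_edges_def by blast
      show "e \<in> ?R"
      proof (cases i)
        case 0
        then show ?thesis using i by simp
      next
        case (Suc j)
        then show ?thesis using i unfolding path_edges_def by auto
      qed
    qed
    have "{a, b} \<in> ?L"
      unfolding path_edges_def by (auto intro!: exI[of _ 0])
    moreover have "{(b # xs) ! i, (b # xs) ! Suc i} \<in> ?L" if "Suc i < length (b # xs)" for i
      unfolding path_edges_def using that by (intro CollectI exI[of _ "Suc i"]) auto
    ultimately show "?R \<subseteq> ?L"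
      unfolding path_edges_def[of "b # xs"] by blast
  qed
qed (simp_all add: path_edges_def)

lemma path_edges_simple:
  assumes "distinct xs" "e \<in> path_edges xs"
  shows "e \<subseteq> set xs \<and> card e = 2"
  using assms by (induction xs rule: induct_list012) auto

lemma finite_path_edges [simp]: "finite (path_edges xs)"
  by (induction xs rule: induct_list012) auto

lemma card_path_edges: "distinct xs \<Longrightarrow> card (path_edges xs) = length xs - 1"
proof (induction xs rule: induct_list012)
  case (3 a b xs)
  then have "{a, b} \<notin> path_edges (b # xs)" using path_edges_simple[of "b # xs" "{a, b}"] by auto
  with 3 show ?case by simp
qed auto

definition fan_edges :: "'a \<Rightarrow> 'a list \<Rightarrow> 'a set set" where
  "fan_edges h ws = path_edges ws \<union> {{h, w} | w. w \<in> set ws}"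

lemma finite_fan_edges [simp]: "finite (fan_edges h ws)"
  by (simp add: fan_edges_def)

lemma fan_edges_simple:
  assumes "distinct (h # ws)" "e \<in> fan_edges h ws"
  shows "e \<subseteq> insert h (set ws) \<and> card e = 2"
  using assms path_edges_simple[of ws e] by (auto simp: fan_edges_def card_2_iff)

text \<open>The induction follows the recursion of \<open>fan\<close>. No edge of the shorter fan
  contains \<open>w\<close>, so the two edges at \<open>w\<close> are new and contribute separate
  factors.\<close>

lemma edge_poly_fan_edges:
  assumes "distinct (h # ws)" "oriented lt (fan_edges h ws)"
  shows "up_to_sign (edge_poly lt (fan_edges h ws)) (fan h ws)"
  using assms
proof (induction h ws rule: fan.induct)
  case (1 h)
  then show ?case by (simp add: fan_edges_def)
next
  case (2 h w)
  then show ?case using edge_poly_single[of lt h w] by (simp add: fan_edges_def)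
next
  case (3 h w w' ws)
  let ?E = "fan_edges h (w' # ws)"
  have E: "fan_edges h (w # w' # ws) = insert {w, w'} (insert {h, w} ?E)"
    by (auto simp: fan_edges_def)
  have w: "w \<notin> e" if "e \<in> ?E" for e
    using fan_edges_simple[of h "w' # ws" e] 3(2) that by auto
  then have new: "{h, w} \<notin> ?E" "{w, w'} \<notin> insert {h, w} ?E"
    using 3(2) by (auto simp: doubleton_eq_iff)
  have o: "oriented lt (insert {w, w'} (insert {h, w} ?E))"
    using 3(3) by (simp add: E)
  have o': "oriented lt (insert {h, w} ?E)" "oriented lt ?E"
    using o by (auto intro: oriented_subset)
  have 1: "up_to_sign (edge_poly lt (fan_edges h (w # w' # ws)))
      ((Var w - Var w') * edge_poly lt (insert {h, w} ?E))"
    unfolding E by (rule edge_poly_insert) (use o new in auto)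
  have 2: "up_to_sign (edge_poly lt (insert {h, w} ?E)) ((Var h - Var w) * edge_poly lt ?E)"
    by (rule edge_poly_insert) (use o' new in auto)
  have "up_to_sign (edge_poly lt ?E) (fan h (w' # ws))"
    using 3 o' by auto
  then show ?case
    unfolding fan.simps by (meson 1 2 up_to_sign_trans up_to_sign_mult up_to_sign_refl)
qed

section \<open>Components\<close>

text \<open>Here \<open>rs\<close> is the outer cycle without \<open>v\<close>, so its first and
  last entries are the outer principal vertices. The bound \<open>2\<close> covers these ends as
  well, because they may become inner rim vertices after gluing.\<close>

definition attains ::
    "('a \<Rightarrow> 'a \<Rightarrow> bool) \<Rightarrow> 'a ugraph \<Rightarrow> 'a \<Rightarrow> 'a list \<Rightarrow> nat \<Rightarrow> nat \<Rightarrow> bool" where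
  "attains lt G v rs c d \<longleftrightarrow>
     (\<exists>m. Poly_Mapping.lookup (edge_poly lt (edges G - {{last rs, v}, {v, hd rs}})) m \<noteq> 0 \<and>
          Poly_Mapping.lookup m v = 0 \<and>
          Poly_Mapping.lookup m (hd rs) = c \<and> Poly_Mapping.lookup m (last rs) = d \<and>
          (\<forall>z\<in>verts G. Poly_Mapping.lookup m z \<le> (if z \<in> set rs then 2 else 4)))"

text \<open>The structural facts about a graph and its outer cycle that gluing uses and
  preserves.\<close>

definition rimmed :: "'a ugraph \<Rightarrow> 'a \<Rightarrow> 'a list \<Rightarrow> bool" where
  "rimmed G v rs \<longleftrightarrow>
     finite (edges G) \<and> (\<forall>e\<in>edges G. e \<subseteq> verts G \<and> card e = 2) \<and>
     distinct (v # rs) \<and> length rs \<ge> 2 \<and> insert v (set rs) \<subseteq> verts G \<and>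
     {v, hd rs} \<in> edges G \<and> {v, last rs} \<in> edges G"

section \<open>Edges of a single component\<close>

lemma cycle_edges_Cons:
  "rs \<noteq> [] \<Longrightarrow> cycle_edges (v # rs) = {{last rs, v}, {v, hd rs}} \<union> path_edges rs"
  by (cases rs) (auto simp: cycle_edges_def)

lemma principal_not_path_edge:
  assumes "distinct (v # rs)"
  shows "{v, z} \<notin> path_edges rs" "{z, v} \<notin> path_edges rs"
  using assms path_edges_simple[of rs "{v, z}"] by (auto simp: insert_commute)

text \<open>Deleting the principal path opens the rim to the path \<open>rs\<close>. Together with
  the wheel hub \<open>u\<close> it forms a fan, and the only further edge is the spoke to
  \<open>v\<close>.\<close>

lemma ordinary_wheel_edges:
  assumes "ordinary_wheel H (v # rs) u"
  shows "edges H - {{last rs, v}, {v, hd rs}} = insert {u, v} (fan_edges u rs)"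
proof -
  have "rs \<noteq> []" "distinct (u # v # rs)"
    and E: "edges H = cycle_edges (v # rs) \<union> {{u, z} | z. z \<in> set (v # rs)}"
    using assms by (auto simp: ordinary_wheel_def)
  then show ?thesis
    using principal_not_path_edge[of v rs] hd_in_set[of rs] last_in_set[of rs]
    unfolding E fan_edges_def cycle_edges_Cons[OF \<open>rs \<noteq> []\<close>]
    by (auto simp: doubleton_eq_iff)
qed

lemma broken_wheel_edges: "broken_wheel H (v # rs) \<Longrightarrow> edges H = fan_edges v rs"
  by (simp add: broken_wheel_def fan_edges_def)

lemma rimmed_component:
  assumes "wheel_component H (v # rs)"
  shows "rimmed H v rs"
proof -
  have rs: "rs \<noteq> []" "length rs \<ge> 2" "distinct (v # rs)"
    using assms by (auto simp: wheel_component_def ordinary_wheel_def broken_wheel_def)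
  have ends: "hd rs \<in> set rs" "last rs \<in> set rs" using rs by auto
  consider u where "ordinary_wheel H (v # rs) u" | "broken_wheel H (v # rs)"
    using assms unfolding wheel_component_def by blast
  then show ?thesis
  proof cases
    case 1
    then have V: "verts H = insert u (insert v (set rs))" "distinct (u # v # rs)"
      and E: "edges H = cycle_edges (v # rs) \<union> {{u, z} | z. z \<in> set (v # rs)}"
      by (auto simp: ordinary_wheel_def)
    have "e \<subseteq> verts H \<and> card e = 2" if "e \<in> edges H" for e
      using that V ends path_edges_simple[of rs e]
      unfolding E cycle_edges_Cons[OF rs(1)] by (auto simp: card_2_iff)
    moreover have "finite (edges H)" "{v, hd rs} \<in> edges H" "{v, last rs} \<in> edges H"
      unfolding E cycle_edges_Cons[OF rs(1)] by (auto simp: insert_commute)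
    ultimately show ?thesis using V rs by (auto simp: rimmed_def)
  next
    case 2
    then have V: "verts H = insert v (set rs)" and E: "edges H = fan_edges v rs"
      using broken_wheel_edges[OF 2] by (simp_all add: broken_wheel_def)
    show ?thesis
      using V rs ends fan_edges_simple[of v rs] unfolding rimmed_def E
      by (auto simp: fan_edges_def)
  qed
qed

section \<open>Recognizing even wheels by counting edges and vertices\<close>

lemma card_edges_ordinary:
  assumes "ordinary_wheel H vs u"
  shows "card (edges H) = 2 * length vs" "card (verts H) = Suc (length vs)"
proof -
  obtain a b c xs where vs: "vs = a # b # c # xs"
    using assms
    by (auto simp: ordinary_wheel_def numeral_3_eq_3 Suc_le_length_iff)
  have d: "distinct (u # vs)"
    and E: "edges H = cycle_edges vs \<union> {{u, z} | z. z \<in> set vs}"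
    and V: "verts H = insert u (set vs)"
    using assms by (auto simp: ordinary_wheel_def)
  show "card (verts H) = Suc (length vs)"
    using V d by (simp add: distinct_card)
  \<comment> \<open>The rim has at least three vertices, so the closing edge differs from the first
    path edge; all other path edges avoid \<open>a\<close>.\<close>
  have "{last vs, a} \<notin> path_edges vs"
    using d path_edges_simple[of "b # c # xs" "{last (c # xs), a}"] last_in_set[of "c # xs"]
    by (auto simp: vs doubleton_eq_iff)
  then have "card (cycle_edges vs) = length vs"
    using d card_path_edges[of vs] by (simp add: cycle_edges_def vs del: path_edges_Cons)
  moreover have "{{u, z} | z. z \<in> set vs} = (\<lambda>z. {u, z}) ` set vs" by auto
  then have "card {{u, z} | z. z \<in> set vs} = length vs"
    using d by (simp add: card_image inj_on_def doubleton_eq_iff distinct_card)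
  moreover have "u \<notin> e" if "e \<in> cycle_edges vs" for e
    using that d path_edges_simple[of vs e] last_in_set[of vs]
    by (auto simp: cycle_edges_def vs simp del: path_edges_Cons last.simps)
  then have "cycle_edges vs \<inter> {{u, z} | z. z \<in> set vs} = {}" by blast
  ultimately show "card (edges H) = 2 * length vs"
    unfolding E by (subst card_Un_disjoint) (auto simp: cycle_edges_def)
qed

lemma card_edges_broken:
  assumes "broken_wheel H vs"
  shows "card (edges H) + 3 \<le> 2 * card (verts H)"
proof -
  have l: "length vs \<ge> 3" and d: "distinct vs"
    and E: "edges H = path_edges (tl vs) \<union> (\<lambda>z. {hd vs, z}) ` set (tl vs)"
    and V: "verts H = set vs"
    using assms by (auto simp: broken_wheel_def)
  have "card (edges H) \<le> card (path_edges (tl vs)) + card ((\<lambda>z. {hd vs, z}) ` set (tl vs))"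
    unfolding E by (rule card_Un_le)
  also have "\<dots> \<le> (length (tl vs) - 1) + length (tl vs)"
    using d card_path_edges[of "tl vs"] card_image_le[of "set (tl vs)" "\<lambda>z. {hd vs, z}"]
    by (simp add: distinct_tl distinct_card)
  finally show ?thesis using l V d by (simp add: distinct_card)
qed

text \<open>The cycle witnessing \<open>is_even_wheel\<close> need not be \<open>vs\<close>, so an
  invariant is used. With \<open>n\<close> vertices an ordinary wheel has \<open>2 * n - 2\<close>
  edges and a broken wheel at most \<open>2 * n - 3\<close>. Hence \<open>vs\<close> lists an
  ordinary wheel, and the number of edges fixes its length.\<close>

lemma even_wheel_component:
  assumes "is_even_wheel H" "wheel_component H vs"
  shows "\<exists>u. ordinary_wheel H vs u \<and> even (length vs)"
proof -
  obtain vs' u' where w: "ordinary_wheel H vs' u'" "even (length vs')"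
    using assms(1) unfolding is_even_wheel_def by blast
  have "\<not> broken_wheel H vs"
    using card_edges_broken[of H vs] card_edges_ordinary[OF w(1)] by auto
  then obtain u where u: "ordinary_wheel H vs u"
    using assms(2) unfolding wheel_component_def by blast
  then show ?thesis
    using card_edges_ordinary[OF w(1)] card_edges_ordinary[OF u] w(2) by auto
qed

section \<open>Monomials of a single component\<close>

lemma rim_split:
  assumes "length rs \<ge> 2"
  obtains w ws x where "rs = w # ws @ [x]"
proof -
  obtain w rs' where "rs = w # rs'" "rs' \<noteq> []"
    using assms by (cases rs) fastforce+
  then show thesis using that by (cases rs' rule: rev_cases) auto
qed

text \<open>As \<open>v\<close> has exponent \<open>0\<close>, the spoke \<open>uv\<close> must
  contribute \<open>u\<close>. This raises the exponent of \<open>u\<close> from at most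
  \<open>3\<close> in the fan to at most \<open>4\<close>.\<close>

lemma attains_ordinary:
  assumes H: "ordinary_wheel H (v # w # ws @ [x]) u" and o: "oriented lt (edges H)"
    and m: "Poly_Mapping.lookup (fan u (w # ws @ [x])) m \<noteq> 0"
    and "Poly_Mapping.lookup m v = 0"
    "Poly_Mapping.lookup m w = c" "Poly_Mapping.lookup m x = d"
    "c \<le> 2" "d \<le> 2" "\<forall>z\<in>set ws. Poly_Mapping.lookup m z \<le> 2" "Poly_Mapping.lookup m u \<le> 3"
  shows "attains lt H v (w # ws @ [x]) c d"
proof -
  let ?rs = "w # ws @ [x]"
  have d: "distinct (u # v # ?rs)" and V: "verts H = insert u (insert v (set ?rs))"
    using H by (auto simp: ordinary_wheel_def)
  have E: "edges H - {{last ?rs, v}, {v, hd ?rs}} = insert {u, v} (fan_edges u ?rs)"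
    by (rule ordinary_wheel_edges[OF H])
  then have o1: "oriented lt (insert {u, v} (fan_edges u ?rs))"
    using oriented_subset[OF o] by blast
  then have "oriented lt (fan_edges u ?rs)"
    by (rule oriented_subset) auto
  moreover have "{u, v} \<notin> fan_edges u ?rs"
    using fan_edges_simple[of u ?rs "{u, v}"] d by auto
  moreover have "distinct (u # ?rs)" using d by simp
  ultimately have s: "up_to_sign (edge_poly lt (insert {u, v} (fan_edges u ?rs)))
      ((Var u - Var v) * fan u ?rs)"
    by (intro up_to_sign_trans[OF edge_poly_insert[OF o1]] up_to_sign_mult edge_poly_fan_edges)
      simp_all
  have "Poly_Mapping.lookup ((Var u - Var v) * fan u ?rs) (Poly_Mapping.single u 1 + m) \<noteq> 0"
    using d m assms(4) lookup_diff_Var_mult[of m v u "fan u ?rs"] by auto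
  then have "Poly_Mapping.lookup (edge_poly lt (insert {u, v} (fan_edges u ?rs)))
      (Poly_Mapping.single u 1 + m) \<noteq> 0"
    using up_to_sign_lookup[OF s] by blast
  then show ?thesis
    unfolding attains_def E
    using d V assms(4-)
    by (intro exI[of _ "Poly_Mapping.single u 1 + m"])
      (auto simp: lookup_add lookup_single when_def)
qed

lemma attains_even:
  assumes H: "ordinary_wheel H (v # rs) u" and o: "oriented lt (edges H)"
    and even: "even (length (v # rs))"
  shows "attains lt H v rs 0 0"
proof -
  have "length rs \<ge> 2" using H by (auto simp: ordinary_wheel_def)
  then obtain w ws x where rs: "rs = w # ws @ [x]" by (rule rim_split)
  have d: "distinct (u # v # w # ws @ [x])" using H rs by (auto simp: ordinary_wheel_def)
  \<comment> \<open>The ends take \<open>0\<close>, so the hub takes the remaining \<open>3\<close>.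
    An even rim including \<open>v\<close> leaves an odd number of inner path vertices, for which
    this coefficient is \<open>-1\<close> and not \<open>0\<close>.\<close>
  then obtain m where m: "fan_exponents u w ws x 0 0 3 m"
    using ex_fan_exponents[of u w ws x 0 0 3] by auto
  then have "Poly_Mapping.lookup (fan u (w # ws @ [x])) m \<noteq> 0"
    using lookup_fan[OF _ m] d even by (simp add: rs fan_value_def)
  then show ?thesis
    unfolding rs
    by (rule attains_ordinary[OF H[unfolded rs] o]) (use m d in \<open>auto simp: fan_exponents_def\<close>)
qed

text \<open>
  If the number of inner vertices is odd, the coefficient with all inner exponents equal to \<open>2\<close>
  vanishes; lowering the exponent of the first inner vertex to \<open>1\<close>
  and raising that of the hub avoids the cancellation.
\<close>

lemma ex_fan_exponent_0_1:
  assumes "distinct (v # u # w # ws @ [x])"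
  shows "\<exists>m. Poly_Mapping.lookup (fan u (w # ws @ [x])) m \<noteq> 0 \<and>
    Poly_Mapping.lookup m v = 0 \<and> Poly_Mapping.lookup m w = 0 \<and> Poly_Mapping.lookup m x = 1 \<and>
    (\<forall>z\<in>set ws. Poly_Mapping.lookup m z \<le> 2) \<and> Poly_Mapping.lookup m u \<le> 3"
proof (cases "even (length ws)")
  case True
  obtain m where m: "fan_exponents u w ws x 0 1 2 m"
    using ex_fan_exponents[of u w ws x 0 1 2] assms by auto
  have "Poly_Mapping.lookup (fan u (w # ws @ [x])) m \<noteq> 0"
    using lookup_fan[OF _ m] assms True by (simp add: fan_value_def)
  then show ?thesis using m assms by (intro exI[of _ m]) (auto simp: fan_exponents_def)
next
  case False
  then obtain w' ws' where ws: "ws = w' # ws'" by (cases ws) auto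
  have d: "distinct (u # w' # ws' @ [x])" "distinct (u # w # w' # ws' @ [x])"
    using assms ws by auto
  then obtain k where k: "fan_exponents u w' ws' x 0 1 2 k"
    using ex_fan_exponents[of u w' ws' x 0 1 2] by auto
  \<comment> \<open>The path from \<open>w'\<close> on has an even number of inner vertices, so
    \<open>k\<close> has a nonzero coefficient there. Exponent \<open>0\<close> at \<open>w\<close>
    forces the term \<open>- w'*h\<close> with hub \<open>u\<close>, which raises \<open>w'\<close>
    to \<open>1\<close> and \<open>u\<close> to \<open>3\<close>.\<close>
  let ?m = "k + Poly_Mapping.single u 1 + Poly_Mapping.single w' 1"
  have k': "Poly_Mapping.lookup (fan u (w' # ws' @ [x])) k \<noteq> 0"
    using lookup_fan[OF d(1) k] False ws by (simp add: fan_value_def)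
  have 0: "Poly_Mapping.lookup ?m w = 0" "Poly_Mapping.lookup ?m w' \<noteq> 0"
    "Poly_Mapping.lookup ?m u \<noteq> 0"
    using k d by (auto simp: fan_exponents_def lookup_add lookup_single when_def)
  have "Poly_Mapping.lookup (fan u (w # ws @ [x])) ?m \<noteq> 0"
    using lookup_fan_Cons(1)[OF d(2) 0(1)] 0 k' by (simp add: ws del: fan.simps)
  then show ?thesis
    using k d assms ws
    by (intro exI[of _ ?m]) (auto simp: fan_exponents_def lookup_add lookup_single when_def)
qed

text \<open>
  All edges of a broken wheel form a fan with hub \<open>v\<close>, so the factors of the two principal
  edges are divided out of the fan polynomial.
\<close>

lemma attains_broken:
  assumes H: "broken_wheel H (v # w # ws @ [x])" and o: "oriented lt (edges H)"
  shows "attains lt H v (w # ws @ [x]) 0 1"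
proof -
  let ?rs = "w # ws @ [x]"
  have d: "distinct (v # ?rs)" and V: "verts H = insert v (set ?rs)"
    using H by (auto simp: broken_wheel_def)
  have E: "edges H = fan_edges v ?rs" by (rule broken_wheel_edges[OF H])
  define F where "F = edges H - {{last ?rs, v}, {v, hd ?rs}}"
  have F: "edges H = insert {v, w} (insert {v, x} F)"
    unfolding F_def E by (auto simp: fan_edges_def insert_commute)
  have "finite F" unfolding F_def E by simp
  have new: "{v, x} \<notin> F" "{v, w} \<notin> insert {v, x} F"
    using d by (auto simp: F_def doubleton_eq_iff insert_commute)
  have o1: "oriented lt (insert {v, w} (insert {v, x} F))" using o F by simp
  then have o2: "oriented lt (insert {v, x} F)" by (rule oriented_subset) auto
  have 1: "up_to_sign (edge_poly lt (edges H)) ((Var v - Var w) * edge_poly lt (insert {v, x} F))"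
    unfolding F by (rule edge_poly_insert[OF o1]) (use \<open>finite F\<close> new in auto)
  have 2: "up_to_sign (edge_poly lt (insert {v, x} F)) ((Var v - Var x) * edge_poly lt F)"
    by (rule edge_poly_insert[OF o2]) (use \<open>finite F\<close> new in auto)
  have "up_to_sign (edge_poly lt (edges H)) (fan v ?rs)"
    unfolding E by (rule edge_poly_fan_edges[OF d]) (use o E in simp)
  moreover have "up_to_sign (edge_poly lt (edges H))
      ((Var v - Var w) * ((Var v - Var x) * edge_poly lt F))"
    by (rule up_to_sign_trans[OF 1 up_to_sign_mult[OF up_to_sign_refl 2]])
  ultimately have s: "up_to_sign (fan v ?rs)
      ((Var v - Var w) * ((Var v - Var x) * edge_poly lt F))"
    by (auto simp: up_to_sign_def)
  \<comment> \<open>The target exponents \<open>(0, 1)\<close> are each raised by one for the two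
    principal edges, with \<open>0\<close> kept at \<open>v\<close>. For exponent \<open>2\<close>
    at the last vertex the coefficient is nonzero whatever the number of inner vertices.\<close>
  obtain m where m: "fan_exponents v w ws x 1 2 0 m"
    using ex_fan_exponents[of v w ws x 1 2 0] d by auto
  let ?m = "m - Poly_Mapping.single w 1 - Poly_Mapping.single x 1"
  have mv: "Poly_Mapping.lookup m v = 0" "v \<noteq> w" "v \<noteq> x" "w \<noteq> v"
    using m d by (auto simp: fan_exponents_def)
  have "Poly_Mapping.lookup (fan v ?rs) m \<noteq> 0"
    using lookup_fan[OF _ m] d by (simp add: fan_value_def)
  then have "Poly_Mapping.lookup ((Var v - Var w) * ((Var v - Var x) * edge_poly lt F)) m \<noteq> 0"
    using up_to_sign_lookup[OF s] by blast
  \<comment> \<open>Since \<open>v\<close> does not occur in \<open>m\<close>, only the product of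
    \<open>w\<close> and \<open>x\<close> from the two principal factors can contribute.\<close>
  then have "Poly_Mapping.lookup (edge_poly lt F) ?m \<noteq> 0"
    using mv
    by (auto simp: left_diff_distrib lookup_minus lookup_Var_mult lookup_single split: if_splits)
  then show ?thesis
    unfolding attains_def F_def using m d V
    by (intro exI[of _ ?m]) (auto simp: fan_exponents_def lookup_minus lookup_single when_def)
qed

lemma attains_0_1:
  assumes H: "wheel_component H (v # rs)" and o: "oriented lt (edges H)"
  shows "attains lt H v rs 0 1"
proof -
  have "length rs \<ge> 2"
    using H by (auto simp: wheel_component_def ordinary_wheel_def broken_wheel_def)
  then obtain w ws x where rs: "rs = w # ws @ [x]" by (rule rim_split)
  show ?thesis
  proof (cases "broken_wheel H (v # rs)")
    case True
    then show ?thesis using attains_broken[of H v w ws x lt] o unfolding rs by auto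
  next
    case False
    then obtain u where u: "ordinary_wheel H (v # w # ws @ [x]) u"
      using H rs unfolding wheel_component_def by blast
    then have "distinct (v # u # w # ws @ [x])" by (auto simp: ordinary_wheel_def)
    from ex_fan_exponent_0_1[OF this] obtain m where
      "Poly_Mapping.lookup (fan u (w # ws @ [x])) m \<noteq> 0" "Poly_Mapping.lookup m v = 0"
      "Poly_Mapping.lookup m w = 0" "Poly_Mapping.lookup m x = 1"
      "\<forall>z\<in>set ws. Poly_Mapping.lookup m z \<le> 2" "Poly_Mapping.lookup m u \<le> 3"
      by blast
    then show ?thesis
      unfolding rs by (intro attains_ordinary[OF u o]) auto
  qed
qed

section \<open>Reversing a component\<close>

lemma path_edges_rev: "path_edges (rev xs) = path_edges xs"
proof -
  have sub: "path_edges (rev xs) \<subseteq> path_edges xs" for xs :: "'a list"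
  proof
    fix e assume "e \<in> path_edges (rev xs)"
    then obtain i where i: "Suc i < length xs" "e = {rev xs ! i, rev xs ! Suc i}"
      unfolding path_edges_def by auto
    \<comment> \<open>Reversal exchanges the edge positions \<open>i\<close> and
      \<open>length xs - 2 - i\<close>.\<close>
    define j where "j = length xs - Suc (Suc i)"
    have "rev xs ! i = xs ! Suc j" "rev xs ! Suc i = xs ! j" "Suc j < length xs"
      using i(1) by (auto simp: j_def rev_nth Suc_diff_Suc)
    with i(2) show "e \<in> path_edges xs"
      unfolding path_edges_def by (auto simp: insert_commute)
  qed
  show ?thesis using sub[of xs] sub[of "rev xs"] by auto
qed

lemma wheel_component_rev:
  assumes "wheel_component H (v # rs)"
  shows "wheel_component H (v # rev rs)"
proof -
  have "rs \<noteq> []" using assms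
    by (auto simp: wheel_component_def ordinary_wheel_def broken_wheel_def)
  then have "cycle_edges (v # rev rs) = cycle_edges (v # rs)"
    by (simp add: cycle_edges_Cons path_edges_rev hd_rev last_rev insert_commute)
  with assms show ?thesis
    by (simp add: wheel_component_def ordinary_wheel_def broken_wheel_def path_edges_rev)
qed

text \<open>Listing the component in the other direction swaps its two ends and keeps the deleted
  pair of edges.\<close>

lemma attains_1_0:
  assumes "wheel_component H (v # rs)" "oriented lt (edges H)"
  shows "attains lt H v rs 1 0"
proof -
  have "attains lt H v (rev rs) 0 1"
    using assms by (intro attains_0_1 wheel_component_rev)
  moreover have "{{hd rs, v}, {v, last rs}} = {{last rs, v}, {v, hd rs}}"
    by (simp add: insert_commute)
  ultimately show ?thesis
    unfolding attains_def hd_rev last_rev set_rev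
    by (elim exE conjE, intro exI conjI) (simp_all only: not_False_eq_True)
qed

section \<open>Gluing\<close>

lemma graph_union_simps [simp]:
  "verts (graph_union G H) = verts G \<union> verts H"
  "edges (graph_union G H) = edges G \<union> edges H"
  by (simp_all add: graph_union_def)

lemma rimmed_graph_union:
  assumes G: "rimmed G v (ps @ [x])" and H: "rimmed H v (x # qs)"
    and VH: "verts G \<inter> verts H = {v, x}"
  shows "rimmed (graph_union G H) v (ps @ x # qs)"
proof -
  have "ps \<noteq> []" "qs \<noteq> []" using G H by (auto simp: rimmed_def)
  moreover have "set ps \<inter> set qs = {}"
    using G H VH unfolding rimmed_def by auto
  ultimately show ?thesis
    using G H unfolding rimmed_def by auto
qed

text \<open>The edge \<open>xv\<close> is deleted from both sides when their principal paths are
  removed, but after gluing it is no longer principal. It is the only common edge, so it comes back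
  exactly once and the rest is a disjoint union.\<close>

lemma edges_graph_union:
  assumes G: "rimmed G v (ps @ [x])" and H: "rimmed H v (x # qs)"
    and VH: "verts G \<inter> verts H = {v, x}"
  defines "E \<equiv> edges G - {{x, v}, {v, hd ps}}"
    and "F \<equiv> edges H - {{last qs, v}, {v, x}}"
  shows "edges (graph_union G H) - {{last qs, v}, {v, hd ps}} = insert {x, v} (E \<union> F)"
    and "{x, v} \<notin> E \<union> F" and "E \<inter> F = {}"
proof -
  have ne: "ps \<noteq> []" "qs \<noteq> []" using G H by (auto simp: rimmed_def)
  have "hd ps \<in> set ps" "last qs \<in> set qs" using ne by auto
  then have p: "hd ps \<in> verts G" "hd ps \<noteq> x" "hd ps \<noteq> v"
    and q: "last qs \<in> verts H" "last qs \<noteq> x" "last qs \<noteq> v" and x: "x \<noteq> v"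
    using G H unfolding rimmed_def by auto
  have EG: "e \<subseteq> verts G" "card e = 2" if "e \<in> edges G" for e
    using that G unfolding rimmed_def by blast+
  have EH: "e \<subseteq> verts H" if "e \<in> edges H" for e
    using that H unfolding rimmed_def by blast
  have common: "e = {x, v}" if "e \<in> edges G" "e \<in> edges H" for e
  proof -
    have "e \<subseteq> {v, x}" "card e = 2" using EG[OF that(1)] EH[OF that(2)] VH by blast+
    then have "e = {v, x}" using x by (intro card_subset_eq) simp_all
    then show ?thesis by (simp add: insert_commute)
  qed
  have xv: "{x, v} \<in> edges G"
    using G by (simp add: rimmed_def insert_commute)
  have "{v, hd ps} \<notin> edges H" "{last qs, v} \<notin> edges G"
  proof -
    have "hd ps \<notin> verts H" "last qs \<notin> verts G" using p q VH by auto
    then show "{v, hd ps} \<notin> edges H" "{last qs, v} \<notin> edges G"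
      using EG(1) EH by blast+
  qed
  moreover have "{x, v} \<noteq> {v, hd ps}" "{x, v} \<noteq> {last qs, v}"
    using p q x by (simp_all add: doubleton_eq_iff)
  \<comment> \<open>The set identity behind the claim, with the edges as atoms: \<open>g\<close> is
    the glued edge, \<open>e\<close> and \<open>f\<close> are the outer principal edges of the two
    sides.\<close>
  moreover have "A \<union> B - {f, e} = insert g ((A - {g, e}) \<union> (B - {f, g}))"
    if "e \<notin> B" "f \<notin> A" "g \<noteq> e" "g \<noteq> f" "g \<in> A" for A B and e f g :: "'a set"
    using that by blast
  ultimately show "edges (graph_union G H) - {{last qs, v}, {v, hd ps}} = insert {x, v} (E \<union> F)"
    using xv unfolding E_def F_def insert_commute[of v x "{}"] graph_union_simps by blast
  show "{x, v} \<notin> E \<union> F"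
    unfolding E_def F_def insert_commute[of v x "{}"] by simp
  show "E \<inter> F = {}" using common unfolding E_def F_def by blast
qed

text \<open>As \<open>v\<close> has exponent \<open>0\<close>, the factor \<open>x - v\<close>
  contributes \<open>x\<close>, so the exponent of \<open>x\<close> is
  \<open>d + c' + 1 = 2\<close>. Every vertex other than \<open>v\<close> and \<open>x\<close> lies
  on one side only and keeps its exponent and its bound.\<close>

lemma attains_graph_union:
  assumes G: "rimmed G v (ps @ [x])" and H: "rimmed H v (x # qs)"
    and VH: "verts G \<inter> verts H = {v, x}"
    and o: "oriented lt (edges (graph_union G H))"
    and aG: "attains lt G v (ps @ [x]) c d" and aH: "attains lt H v (x # qs) c' d'"
    and cd: "d + c' = 1"
  shows "attains lt (graph_union G H) v (ps @ x # qs) c d'"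
proof -
  have ne: "ps \<noteq> []" "qs \<noteq> []" using G H by (auto simp: rimmed_def)
  have ends: "hd ps \<in> set ps" "last qs \<in> set qs" using ne by auto
  have out: "hd ps \<notin> verts H" "last qs \<notin> verts G" "v \<noteq> x" "set qs \<inter> verts G = {}"
    "v \<notin> set ps" "v \<notin> set qs" "x \<notin> set ps" "x \<notin> set qs" "x \<in> verts G" "set ps \<subseteq> verts G"
    "v \<in> verts G" "set ps \<inter> verts H = {}"
    using G H VH ends unfolding rimmed_def by auto
  define E where "E = edges G - {{x, v}, {v, hd ps}}"
  define F where "F = edges H - {{last qs, v}, {v, x}}"
  note EF = edges_graph_union[OF G H VH, folded E_def F_def]
  obtain a where a: "Poly_Mapping.lookup (edge_poly lt E) a \<noteq> 0" "Poly_Mapping.lookup a v = 0"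
    "Poly_Mapping.lookup a (hd ps) = c" "Poly_Mapping.lookup a x = d"
    "\<And>z. z \<in> verts G \<Longrightarrow> Poly_Mapping.lookup a z \<le> (if z \<in> set (ps @ [x]) then 2 else 4)"
    using aG ne unfolding attains_def E_def by auto
  obtain b where b: "Poly_Mapping.lookup (edge_poly lt F) b \<noteq> 0" "Poly_Mapping.lookup b v = 0"
    "Poly_Mapping.lookup b x = c'" "Poly_Mapping.lookup b (last qs) = d'"
    "\<And>z. z \<in> verts H \<Longrightarrow> Poly_Mapping.lookup b z \<le> (if z \<in> set (x # qs) then 2 else 4)"
    using aH ne unfolding attains_def F_def by auto
  have fin: "finite E" "finite F" using G H by (auto simp: E_def F_def rimmed_def)
  have oEF: "oriented lt (insert {x, v} (E \<union> F))"
    using oriented_subset[OF o] EF(1) by blast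
  have oE: "oriented lt E" and oF: "oriented lt F" and oEuF: "oriented lt (E \<union> F)"
    by (rule oriented_subset[OF oEF], blast)+
  have hE: "homog (verts G) (card (arcs lt E)) (edge_poly lt E)"
    by (rule homog_edge_poly[OF oE fin(1)]) (use G in \<open>unfold rimmed_def E_def, blast\<close>)
  have hF: "homog (verts H) (card (arcs lt F)) (edge_poly lt F)"
    by (rule homog_edge_poly[OF oF fin(2)]) (use H in \<open>unfold rimmed_def F_def, blast\<close>)
  have aout: "Poly_Mapping.lookup a z = 0" if "z \<notin> verts G" for z
    using hE a(1) that unfolding homog_def by (meson in_keys_iff subsetD)
  have bout: "Poly_Mapping.lookup b z = 0" if "z \<notin> verts H" for z
    using hF b(1) that unfolding homog_def by (meson in_keys_iff subsetD)
  have ab: "Poly_Mapping.lookup (edge_poly lt E * edge_poly lt F) (a + b) \<noteq> 0"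
    using hE hF _ a(1) b(1) a(2) b(2) by (rule lookup_mult_glue) (use VH in auto)
  have "up_to_sign (edge_poly lt (insert {x, v} (E \<union> F)))
      ((Var x - Var v) * (edge_poly lt E * edge_poly lt F))"
    using edge_poly_insert[OF oEF] edge_poly_Un[OF oEuF fin EF(3)] EF(2) fin by simp
  moreover have "Poly_Mapping.lookup ((Var x - Var v) * (edge_poly lt E * edge_poly lt F))
      (Poly_Mapping.single x 1 + (a + b)) \<noteq> 0"
    using ab a(2) b(2) out(3) by (subst lookup_diff_Var_mult) (auto simp: lookup_add)
  ultimately have nz: "Poly_Mapping.lookup (edge_poly lt (insert {x, v} (E \<union> F)))
      (Poly_Mapping.single x 1 + (a + b)) \<noteq> 0"
    using up_to_sign_lookup by blast
  have cap: "Poly_Mapping.lookup (Poly_Mapping.single x 1 + (a + b)) z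
      \<le> (if z \<in> set (ps @ x # qs) then 2 else 4)" if "z \<in> verts G \<union> verts H" for z
  proof -
    have common: "z \<in> {v, x} \<longleftrightarrow> z \<in> verts G \<and> z \<in> verts H"
      unfolding VH[symmetric] by simp
    consider "z = x" | "z = v" | "z \<noteq> x" "z \<in> verts G" "z \<notin> verts H"
      | "z \<noteq> x" "z \<in> verts H" "z \<notin> verts G"
      using \<open>z \<in> verts G \<union> verts H\<close> common unfolding Un_iff insert_iff empty_iff by argo
    then show ?thesis
    proof cases
      case 1
      have "Poly_Mapping.lookup (Poly_Mapping.single x 1 + (a + b)) x = 2"
        using a(4) b(3) cd by (simp add: lookup_add)
      with 1 show ?thesis by simp
    next
      case 2
      have "Poly_Mapping.lookup (Poly_Mapping.single x 1 + (a + b)) v = 0"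
        using a(2) b(2) out(3) by (simp add: lookup_add lookup_single)
      with 2 show ?thesis by simp
    next
      case 3
      then have "z \<notin> set qs" using out(4) by blast
      then show ?thesis
        using a(5)[OF 3(2)] bout[OF 3(3)] 3(1) by (simp add: lookup_add lookup_single)
    next
      case 4
      then have "z \<notin> set ps" using out(12) by blast
      then show ?thesis
        using b(5)[OF 4(2)] aout[OF 4(3)] 4(1) by (simp add: lookup_add lookup_single)
    qed
  qed
  have hl: "hd (ps @ x # qs) = hd ps" "last (ps @ x # qs) = last qs" using ne by auto
  have "x \<noteq> hd ps" "x \<noteq> last qs" using out(7,8) ends by auto
  then have ends_exp: "Poly_Mapping.lookup (Poly_Mapping.single x 1 + (a + b)) v = 0"
    "Poly_Mapping.lookup (Poly_Mapping.single x 1 + (a + b)) (hd ps) = c"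
    "Poly_Mapping.lookup (Poly_Mapping.single x 1 + (a + b)) (last qs) = d'"
    using a(2,3) b(2,4) aout[OF out(2)] bout[OF out(1)] out(3)
    by (simp_all add: lookup_add lookup_single)
  show ?thesis
    unfolding attains_def graph_union_simps(1) hl EF(1)
    using nz cap ends_exp by blast
qed

text \<open>The pair \<open>(0, 1)\<close> is carried along in every case, because it is what a
  later even wheel needs on its left. If the new component is an even wheel, \<open>(0, 1)\<close>
  meets its \<open>(0, 0)\<close>; if an even wheel came earlier, \<open>(0, 0)\<close> meets
  \<open>(1, 0)\<close>. Both give \<open>(0, 0)\<close>, while \<open>(0, 1)\<close> meeting
  \<open>(0, 1)\<close> preserves \<open>(0, 1)\<close>.\<close>

lemma glued_wheels_attains:
  assumes "glued_wheels G vs Hs" "oriented lt (edges G)"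
  shows "rimmed G (hd vs) (tl vs) \<and> attains lt G (hd vs) (tl vs) 0 1 \<and>
    ((\<exists>H\<in>set Hs. is_even_wheel H) \<longrightarrow> attains lt G (hd vs) (tl vs) 0 0)"
  using assms
proof (induction rule: glued_wheels.induct)
  case (single G vs)
  then have "vs \<noteq> []"
    by (auto simp: wheel_component_def ordinary_wheel_def broken_wheel_def)
  then obtain v rs where vs: "vs = v # rs" by (cases vs) auto
  have "attains lt G v rs 0 0" if "is_even_wheel G"
    using even_wheel_component[OF that single(1)] attains_even[of G v rs _ lt] single(2) vs by blast
  then show ?case
    using single vs rimmed_component[of G v rs] attains_0_1[of G v rs lt] by auto
next
  case (glue G v1 ps x Hs H qs)
  have o: "oriented lt (edges G)" "oriented lt (edges H)"
    using glue.prems by (auto elim: oriented_subset)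
  have G: "rimmed G v1 (ps @ [x])" "attains lt G v1 (ps @ [x]) 0 1"
    and G0: "(\<exists>H\<in>set Hs. is_even_wheel H) \<Longrightarrow> attains lt G v1 (ps @ [x]) 0 0"
    using glue.IH[OF o(1)] by auto
  have H: "rimmed H v1 (x # qs)" "attains lt H v1 (x # qs) 0 1" "attains lt H v1 (x # qs) 1 0"
    using rimmed_component[OF glue.hyps(2)] attains_0_1[OF glue.hyps(2) o(2)]
      attains_1_0[OF glue.hyps(2) o(2)] by simp_all
  have H0: "attains lt H v1 (x # qs) 0 0" if "is_even_wheel H"
    using even_wheel_component[OF that glue.hyps(2)] attains_even[of H v1 "x # qs" _ lt] o(2)
    by blast
  note union = attains_graph_union[OF G(1) H(1) glue.hyps(3) glue.prems]
  have "attains lt (graph_union G H) v1 (ps @ x # qs) 0 1"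
    by (rule union[OF G(2) H(2)]) simp
  moreover have "attains lt (graph_union G H) v1 (ps @ x # qs) 0 0"
    if "\<exists>K\<in>set (Hs @ [H]). is_even_wheel K"
  proof (cases "is_even_wheel H")
    case True
    show ?thesis by (rule union[OF G(2) H0[OF True]]) simp
  next
    case False
    then have "\<exists>K\<in>set Hs. is_even_wheel K" using that by auto
    from union[OF G0[OF this] H(3)] show ?thesis by simp
  qed
  ultimately show ?case
    using rimmed_graph_union[OF G(1) H(1) glue.hyps(3)] by simp
qed

theorem theorem5p8:
  fixes G :: "'a ugraph" and Hs :: "'a ugraph list"
    and v1 v2 vk :: 'a and vs :: "'a list"
    and lt :: "'a \<Rightarrow> 'a \<Rightarrow> bool"
  assumes "multiple_wheel G (v1 # v2 # vs @ [vk]) Hs"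
    and "\<exists>H \<in> set Hs. is_even_wheel H"
    and "orientation lt G"
  shows "\<exists>m :: 'a \<Rightarrow>\<^sub>0 nat.
           nonvanishing (graph_poly lt (delete_edges G {{vk, v1}, {v1, v2}})) m \<and>
           Poly_Mapping.keys m \<subseteq> verts G \<and>
           Poly_Mapping.lookup m v1 = 0 \<and>
           Poly_Mapping.lookup m v2 = 0 \<and>
           Poly_Mapping.lookup m vk = 0 \<and>
           (\<forall>v \<in> set vs. Poly_Mapping.lookup m v \<le> 2) \<and>
           (\<forall>u \<in> verts G - set (v1 # v2 # vs @ [vk]). Poly_Mapping.lookup m u \<le> 4)"
proof -
  have o: "oriented lt (edges G)"
    using assms(3) by (simp add: orientation_def oriented_def)
  let ?E = "edges G - {{vk, v1}, {v1, v2}}"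
  from glued_wheels_attains[OF _ o] assms(1,2)
  have R: "rimmed G v1 (v2 # vs @ [vk])" and A: "attains lt G v1 (v2 # vs @ [vk]) 0 0"
    unfolding multiple_wheel_def by fastforce+
  obtain m where m: "Poly_Mapping.lookup (edge_poly lt ?E) m \<noteq> 0" "Poly_Mapping.lookup m v1 = 0"
    "Poly_Mapping.lookup m v2 = 0" "Poly_Mapping.lookup m vk = 0"
    "\<And>z. z \<in> verts G \<Longrightarrow>
      Poly_Mapping.lookup m z \<le> (if z \<in> set (v2 # vs @ [vk]) then 2 else 4)"
    using A unfolding attains_def by auto
  \<comment> \<open>Homogeneity serves here to confine the variables of \<open>m\<close> to the
    vertices of \<open>G\<close>.\<close>
  have "homog (verts G) (card (arcs lt ?E)) (edge_poly lt ?E)"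
    using R o by (intro homog_edge_poly) (auto simp: rimmed_def elim: oriented_subset)
  then have "Poly_Mapping.keys m \<subseteq> verts G"
    using m(1) by (auto simp: homog_def in_keys_iff)
  moreover have "graph_poly lt (delete_edges G {{vk, v1}, {v1, v2}}) = edge_poly lt ?E"
    by (simp add: graph_poly_def edge_poly_def arcs_def delete_edges_def)
  moreover have "Poly_Mapping.lookup m z \<le> 2" if "z \<in> set vs" for z
    using m(5)[of z] R that by (auto simp: rimmed_def)
  moreover have "Poly_Mapping.lookup m z \<le> 4" if "z \<in> verts G" for z
    using m(5)[OF that] by (simp split: if_splits)
  ultimately show ?thesis
    unfolding nonvanishing_def using m by auto
qed

end
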